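(* Let $\mathbf p=(p_1,\dots,p_r)$ and $\mathbf q=(q_1,\dots,q_r)$ be probability distributions on $\mathcal X=\{c_1,\dots,c_r\}$ with $p_j>0$ and $q_j>0$ for all $j\in D$, and let $\phi:[0,1]^2\to\mathbb R$ be a measurable function having continuous second order partial derivatives. Let $\widehat{\mathbf p}_n$ and $\widehat{\mathbf q}_m$ be the empirical distributions of i.i.d. samples $X_1,\dots,X_n$ from $\mathbf p$ and $Y_1,\dots,Y_m$ from $\mathbf q$. Then: (a) (One sample) $$\limsup_{n\to+\infty}\frac{|J(\widehat{\mathbf p}_n,\mathbf q)-J(\mathbf p,\mathbf q)|}{a_n}\le A_{1,p}\quad\text{a.s.},\qquad \limsup_{m\to+\infty}\frac{|J(\mathbf p,\widehat{\mathbf q}_m)-J(\mathbf p,\mathbf q)|}{b_m}\le A_{2,q}\quad\text{a.s.}$$ (b) (Two samples) $$\limsup_{(n,m)\to(+\infty,+\infty)}\frac{|J(\widehat{\mathbf p}_n,\widehat{\mathbf q}_m)-J(\mathbf p,\mathbf q)|}{c_{n,m}}\le A_{1,p}+A_{2,q}\quad\text{a.s.}$$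
   Context: $\mathcal X=\{c_1,\dots,c_r\}$ with $r\ge 2$ is a finite set of distinct points and $D=\{1,\dots,r\}$. A probability distribution $\mathbf p$ on $\mathcal X$ is identified with the vector $(p_1,\dots,p_r)$, $p_j$ being the mass of $c_j$. $X_1,X_2,\dots$ are i.i.d. with $\mathbb P(X_i=c_j)=p_j$, and $Y_1,Y_2,\dots$ are i.i.d. with $\mathbb P(Y_i=c_j)=q_j$; the two sequences are independent of each other. Empirical probabilities: $\widehat p_n^{c_j}=\frac1n\sum_{i=1}^n 1_{\{X_i=c_j\}}$, $\widehat q_m^{c_j}=\frac1m\sum_{i=1}^m 1_{\{Y_i=c_j\}}$, $\widehat{\mathbf p}_n=(\widehat p_n^{c_j})_{j\in D}$, $\widehat{\mathbf q}_m=(\widehat q_m^{c_j})_{j\in D}$. $a_n=\sup_{j\in D}|\widehat p_n^{c_j}-p_j|$, $b_m=\sup_{j\in D}|\widehat q_m^{c_j}-q_j|$, $c_{n,m}=\max(a_n,b_m)$. The $\phi$-divergence is $J(\mathbf p,\mathbf q)=\sum_{j\in D}\phi(p_j,q_j)$ for any probability distributions $\mathbf p,\mathbf q$ on $\mathcal X$. Write $\phi_1^{(1)}(s,t)=\frac{\partial\phi}{\partial s}(s,t)$, $\phi_2^{(1)}(s,t)=\frac{\partial\phi}{\partial t}(s,t)$, and $A_{1,p}=\sum_{j\in D}|\phi_1^{(1)}(p_j,q_j)|$, $A_{2,q}=\sum_{j\in D}|\phi_2^{(1)}(p_j,q_j)|$. Conventions: a ratio $0/0$ is read as $0$; $\limsup_{(n,m)\to(+\infty,+\infty)}x_{n,m}=\lim_{N\to\infty}\sup_{n,m\ge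 N}x_{n,m}$. *)

theory Defs
  imports "HOL-Probability.Probability"
begin

definition prob_vec :: "nat \<Rightarrow> (nat \<Rightarrow> real) \<Rightarrow> bool" where
  "prob_vec r p \<longleftrightarrow> (\<forall>j\<in>{1..r}. 0 \<le> p j) \<and> (\<Sum>j=1..r. p j) = 1"

(* The sample is indexed from 1: X 0 is unconstrained and never used. *)
definition iid_sample ::
  "'a measure \<Rightarrow> nat \<Rightarrow> (nat \<Rightarrow> 'c) \<Rightarrow> (nat \<Rightarrow> real) \<Rightarrow> (nat \<Rightarrow> 'a \<Rightarrow> 'c) \<Rightarrow> bool" where
  "iid_sample M r c p X \<longleftrightarrow>
     prob_space.indep_vars M (\<lambda>_. count_space (c ` {1..r})) X {1..} \<and>
     (\<forall>i\<ge>1. \<forall>j\<in>{1..r}. measure M {\<omega> \<in> space M. X i \<omega> = c j} = p j)"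

definition indep_samples ::
  "'a measure \<Rightarrow> nat \<Rightarrow> (nat \<Rightarrow> 'c) \<Rightarrow> (nat \<Rightarrow> 'a \<Rightarrow> 'c) \<Rightarrow> (nat \<Rightarrow> 'a \<Rightarrow> 'c) \<Rightarrow> bool" where
  "indep_samples M r c X Y \<longleftrightarrow>
     prob_space.indep_var M
       (\<Pi>\<^sub>M i\<in>{1..}. count_space (c ` {1..r})) (\<lambda>\<omega>. \<lambda>i\<in>{1..}. X i \<omega>)
       (\<Pi>\<^sub>M i\<in>{1..}. count_space (c ` {1..r})) (\<lambda>\<omega>. \<lambda>i\<in>{1..}. Y i \<omega>)"

definition empirical ::
  "(nat \<Rightarrow> 'c) \<Rightarrow> (nat \<Rightarrow> 'a \<Rightarrow> 'c) \<Rightarrow> nat \<Rightarrow> 'a \<Rightarrow> nat \<Rightarrow> real" where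
  "empirical c X n \<omega> j = 1 / real n * (\<Sum>i=1..n. indicat_real {c j} (X i \<omega>))"

definition sup_dev :: "nat \<Rightarrow> (nat \<Rightarrow> real) \<Rightarrow> (nat \<Rightarrow> real) \<Rightarrow> real" where
  "sup_dev r p' p = (SUP j\<in>{1..r}. \<bar>p' j - p j\<bar>)"

definition phi_div ::
  "nat \<Rightarrow> (real \<Rightarrow> real \<Rightarrow> real) \<Rightarrow> (nat \<Rightarrow> real) \<Rightarrow> (nat \<Rightarrow> real) \<Rightarrow> real" where
  "phi_div r \<phi> p q = (\<Sum>j=1..r. \<phi> (p j) (q j))"

(* Functions on the closed unit square are total functions whose values outside the square
   are ignored, so partial derivatives are taken within [0,1]: two-sided in the interior,
   one-sided on the boundary. *)
definition pd1 :: "(real \<Rightarrow> real \<Rightarrow> real) \<Rightarrow> real \<Rightarrow> real \<Rightarrow> real" where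
  "pd1 \<phi> s t = vector_derivative (\<lambda>u. \<phi> u t) (at s within {0..1})"

definition pd2 :: "(real \<Rightarrow> real \<Rightarrow> real) \<Rightarrow> real \<Rightarrow> real \<Rightarrow> real" where
  "pd2 \<phi> s t = vector_derivative (\<lambda>u. \<phi> s u) (at t within {0..1})"

definition has_pds :: "(real \<Rightarrow> real \<Rightarrow> real) \<Rightarrow> bool" where
  "has_pds \<phi> \<longleftrightarrow> (\<forall>s\<in>{0..1}. \<forall>t\<in>{0..1}.
     (\<lambda>u. \<phi> u t) differentiable (at s within {0..1}) \<and>
     (\<lambda>u. \<phi> s u) differentiable (at t within {0..1}))"

definition C2_unit_square :: "(real \<Rightarrow> real \<Rightarrow> real) \<Rightarrow> bool" where
  "C2_unit_square \<phi> \<longleftrightarrow>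
     has_pds \<phi> \<and> has_pds (pd1 \<phi>) \<and> has_pds (pd2 \<phi>) \<and>
     (\<forall>\<psi>\<in>{pd1 (pd1 \<phi>), pd2 (pd1 \<phi>), pd1 (pd2 \<phi>), pd2 (pd2 \<phi>)}.
        continuous_on ({0..1} \<times> {0..1}) (\<lambda>(s, t). \<psi> s t))"

definition A1 ::
  "nat \<Rightarrow> (real \<Rightarrow> real \<Rightarrow> real) \<Rightarrow> (nat \<Rightarrow> real) \<Rightarrow> (nat \<Rightarrow> real) \<Rightarrow> real" where
  "A1 r \<phi> p q = (\<Sum>j=1..r. \<bar>pd1 \<phi> (p j) (q j)\<bar>)"

definition A2 ::
  "nat \<Rightarrow> (real \<Rightarrow> real \<Rightarrow> real) \<Rightarrow> (nat \<Rightarrow> real) \<Rightarrow> (nat \<Rightarrow> real) \<Rightarrow> real" where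
  "A2 r \<phi> p q = (\<Sum>j=1..r. \<bar>pd2 \<phi> (p j) (q j)\<bar>)"

(* The suprema decrease in N, so this limit always exists in the extended reals. *)
definition double_limsup :: "(nat \<Rightarrow> nat \<Rightarrow> ereal) \<Rightarrow> ereal" where
  "double_limsup x = lim (\<lambda>N. SUP (n, m)\<in>{N..} \<times> {N..}. x n m)"

end

theory Submission
  imports Defs
begin

text \<open>
  Hoeffding's inequality and the Borel--Cantelli lemma give the strong law for the empirical
  frequencies, so \<open>a\<^sub>n\<close> and \<open>b\<^sub>m\<close> tend to \<open>0\<close> almost surely. The rest is deterministic: the
  second partial derivatives are bounded on the compact square, so the first partial
  derivatives are Lipschitz, and the mean value theorem in each variable separately yields
  \<open>\<bar>J p' q' - J p q\<bar> \<le> A\<^sub>1 a + A\<^sub>2 b + r K (a + b)\<^sup>2\<close>. Dividing by \<open>a\<close>, \<open>b\<close> or \<open>max a b\<close>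
  leaves an error that is linear in the deviations.
\<close>

section \<open>The strong law for bounded random variables\<close>

text \<open>Hoeffding's bound decays geometrically in the sample size, so for each fixed \<epsilon>
  the probabilities of a deviation of at least \<epsilon> are summable, and by Borel-Cantelli almost
  surely only finitely many such deviations occur.\<close>

lemma (in prob_space) strong_law_bounded:
  fixes Z :: "nat \<Rightarrow> 'a \<Rightarrow> real"
  assumes indep: "indep_vars (\<lambda>_. borel) Z {1..}"
    and bounds: "\<And>i. i \<ge> 1 \<Longrightarrow> AE \<omega> in M. Z i \<omega> \<in> {a..b}"
    and "a < b"
    and mean: "\<And>i. i \<ge> 1 \<Longrightarrow> expectation (Z i) = \<mu>"
  shows "AE \<omega> in M. (\<lambda>n. (\<Sum>i=1..n. Z i \<omega>) / real n) \<longlonglongrightarrow> \<mu>"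
proof -
  have rv: "random_variable borel (Z i)" if "i \<ge> 1" for i
    using indep that by (auto simp: indep_vars_def)
  have conv: "AE \<omega> in M. \<forall>\<^sub>F n in sequentially. \<bar>(\<Sum>i=1..n. Z i \<omega>) / real n - \<mu>\<bar> < \<epsilon>"
    if "\<epsilon> > 0" for \<epsilon>
  proof -
    \<comment> \<open>Multiplying the deviation by the sample size gives the form in which
      Hoeffding's inequality bounds it. The shift to \<open>Suc n\<close> keeps the index set
      nonempty, so that the sum of squared ranges in the exponent is positive.\<close>
    define A where
      "A n = {\<omega> \<in> space M. \<bar>(\<Sum>i=1..Suc n. Z i \<omega>) - real (Suc n) * \<mu>\<bar> \<ge> real (Suc n) * \<epsilon>}" for n
    \<comment> \<open>With n + 1 summands of range b - a, Hoeffding's exponent is -2 (n + 1)^2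
      \<epsilon>^2 / ((n + 1) (b - a)^2). One factor n + 1 cancels, which leaves the (n + 1)-st
      power of \<open>\<rho>\<close>.\<close>
    define \<rho> where "\<rho> = exp (-2 * \<epsilon>\<^sup>2 / (b - a)\<^sup>2)"
    have sets_A: "A n \<in> sets M" for n
    proof -
      have [measurable]: "(\<lambda>\<omega>. \<Sum>i=1..Suc n. Z i \<omega>) \<in> borel_measurable M"
        by (intro borel_measurable_sum rv) auto
      show ?thesis unfolding A_def by measurable
    qed
    have prob_A: "prob (A n) \<le> 2 * \<rho> * \<rho> ^ n" for n
    proof -
      interpret Hoeffding_ineq M "{1..Suc n}" Z "\<lambda>_. a" "\<lambda>_. b" "real (Suc n) * \<mu>"
      proof unfold_locales
        show "indep_vars (\<lambda>_. borel) Z {1..Suc n}"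
          by (rule indep_vars_subset[OF indep]) auto
        show "real (Suc n) * \<mu> \<equiv> \<Sum>i\<in>{1..Suc n}. expectation (Z i)"
          by (rule eq_reflection) (simp add: mean del: sum.cl_ivl_Suc)
      qed (use bounds in auto)
      have "prob (A n) \<le> 2 * exp (-2 * (real (Suc n) * \<epsilon>)\<^sup>2 / (\<Sum>i\<in>{1..Suc n}. (b - a)\<^sup>2))"
        unfolding A_def using \<open>\<epsilon> > 0\<close> \<open>a < b\<close> by (intro Hoeffding_ineq_abs_ge) auto
      also have "-2 * (real (Suc n) * \<epsilon>)\<^sup>2 / (\<Sum>i\<in>{1..Suc n}. (b - a)\<^sup>2)
                 = real (Suc n) * (-2 * \<epsilon>\<^sup>2 / (b - a)\<^sup>2)"
      proof -
        define D where "D = (b - a)\<^sup>2"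
        have "D > 0" using \<open>a < b\<close> by (simp add: D_def)
        then show ?thesis
          unfolding D_def[symmetric]
          by (simp add: field_simps power2_eq_square del: sum.cl_ivl_Suc of_nat_Suc)
      qed
      also have "exp \<dots> = \<rho> ^ Suc n"
        unfolding \<rho>_def by (rule exp_of_nat_mult)
      finally show ?thesis by (simp add: mult.assoc)
    qed
    have "\<rho> < 1" "\<rho> \<ge> 0"
      unfolding \<rho>_def using \<open>\<epsilon> > 0\<close> \<open>a < b\<close> by auto
    then have "summable (\<lambda>n. 2 * \<rho> * \<rho> ^ n)"
      by (intro summable_mult summable_geometric) auto
    then have "summable (\<lambda>n. prob (A n))"
      by (rule summable_comparison_test') (use prob_A in auto)
    then have "AE \<omega> in M. \<forall>\<^sub>F n in sequentially. \<omega> \<in> space M - A n"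
      by (intro borel_cantelli_AE1 sets_A) (auto simp: less_top[symmetric])
    then show ?thesis
    proof eventually_elim
      case (elim \<omega>)
      then have "\<forall>\<^sub>F n in sequentially. \<bar>(\<Sum>i=1..Suc n. Z i \<omega>) / real (Suc n) - \<mu>\<bar> < \<epsilon>"
      proof eventually_elim
        case (elim n)
        then have "\<bar>(\<Sum>i=1..Suc n. Z i \<omega>) - real (Suc n) * \<mu>\<bar> < real (Suc n) * \<epsilon>"
          by (auto simp: A_def not_le)
        moreover have "(\<Sum>i=1..Suc n. Z i \<omega>) / real (Suc n) - \<mu>
            = ((\<Sum>i=1..Suc n. Z i \<omega>) - real (Suc n) * \<mu>) / real (Suc n)"
          by (simp add: diff_divide_distrib del: sum.cl_ivl_Suc of_nat_Suc)
        ultimately show ?case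
          by (simp add: abs_divide pos_divide_less_eq mult.commute del: sum.cl_ivl_Suc of_nat_Suc)
      qed
      then show ?case by (subst (asm) eventually_sequentially_Suc)
    qed
  qed
  \<comment> \<open>Each \<epsilon> has its own exceptional null set. The values 1 / (k + 1) reach
    below every positive number and need only a countable union of these sets.\<close>
  have "AE \<omega> in M. \<forall>k. \<forall>\<^sub>F n in sequentially.
          \<bar>(\<Sum>i=1..n. Z i \<omega>) / real n - \<mu>\<bar> < inverse (real (Suc k))"
    unfolding AE_all_countable by (intro allI conv) simp
  then show ?thesis
  proof eventually_elim
    case (elim \<omega>)
    show ?case
    proof (rule tendstoI)
      fix e :: real assume "e > 0"
      then obtain k where "inverse (real (Suc k)) < e"
        using reals_Archimedean by blast
      then show "\<forall>\<^sub>F n in sequentially. dist ((\<Sum>i=1..n. Z i \<omega>) / real n) \<mu> < e"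
        using elim[rule_format, of k] by (auto simp: dist_real_def elim: eventually_mono)
    qed
  qed
qed

section \<open>Almost sure convergence of the empirical distributions\<close>

lemma empirical_in_unit_interval: "empirical c X n \<omega> j \<in> {0..1}"
proof -
  have "(\<Sum>i=1..n. indicat_real {c j} (X i \<omega>)) \<le> (\<Sum>i=1..n. 1)"
    by (intro sum_mono) (auto simp: indicator_def)
  then show ?thesis
    by (auto simp: empirical_def intro!: divide_nonneg_nonneg sum_nonneg divide_le_eq_1[THEN iffD2])
qed

text \<open>The empirical probability of a point is the average of indicators with values in [0,1]
  and mean \<open>p j\<close>, so the strong law above applies.\<close>

lemma (in prob_space) AE_empirical_tendsto:
  assumes "iid_sample M r c p X" and "j \<in> {1..r}"
  shows "AE \<omega> in M. (\<lambda>n. empirical c X n \<omega> j) \<longlonglongrightarrow> p j"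
proof -
  have indep: "indep_vars (\<lambda>_. count_space (c ` {1..r})) X {1..}"
    and mass: "\<And>i. i \<ge> 1 \<Longrightarrow> prob {\<omega> \<in> space M. X i \<omega> = c j} = p j"
    using assms by (auto simp: iid_sample_def)
  have rv: "X i \<in> measurable M (count_space (c ` {1..r}))" if "i \<ge> 1" for i
    using indep that by (auto simp: indep_vars_def)
  have "AE \<omega> in M. (\<lambda>n. (\<Sum>i=1..n. indicat_real {c j} (X i \<omega>)) / real n) \<longlonglongrightarrow> p j"
  proof (rule strong_law_bounded)
    show "indep_vars (\<lambda>_. borel) (\<lambda>i \<omega>. indicat_real {c j} (X i \<omega>)) {1..}"
      by (rule indep_vars_compose2[OF indep]) auto
    show "AE \<omega> in M. indicat_real {c j} (X i \<omega>) \<in> {0..1}" for i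
      by (auto simp: indicator_def)
    show "expectation (\<lambda>\<omega>. indicat_real {c j} (X i \<omega>)) = p j" if "i \<ge> 1" for i
    proof -
      \<comment> \<open>Here \<open>j \<in> {1..r}\<close> matters: it makes the singleton of
        \<open>c j\<close> a measurable set of the discrete space on the image of
        \<open>c\<close>.\<close>
      have "X i -` {c j} \<inter> space M \<in> sets M"
        by (rule measurable_sets[OF rv[OF that]]) (use assms(2) in auto)
      moreover have "X i -` {c j} \<inter> space M = {\<omega> \<in> space M. X i \<omega> = c j}"
        by auto
      ultimately have "{\<omega> \<in> space M. X i \<omega> = c j} \<in> sets M"
        by simp
      then have "expectation (indicat_real {\<omega> \<in> space M. X i \<omega> = c j}) = p j"
        using mass[OF that] by simp
      moreover have "expectation (\<lambda>\<omega>. indicat_real {c j} (X i \<omega>))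
          = expectation (indicat_real {\<omega> \<in> space M. X i \<omega> = c j})"
        by (intro Bochner_Integration.integral_cong) (auto simp: indicator_def)
      ultimately show ?thesis by simp
    qed
  qed simp
  then show ?thesis
    by (simp add: empirical_def)
qed

lemma abs_diff_le_sup_dev: "j \<in> {1..r} \<Longrightarrow> \<bar>p' j - p j\<bar> \<le> sup_dev r p' p"
  unfolding sup_dev_def by (rule cSUP_upper) auto

text \<open>The condition \<open>r \<ge> 1\<close> supplies an index whose absolute deviation lies
  below the supremum; over an empty index set the real supremum would carry no information.\<close>

lemma sup_dev_nonneg: "r \<ge> 1 \<Longrightarrow> 0 \<le> sup_dev r p' p"
  using abs_diff_le_sup_dev[of 1 r p' p] by force

text \<open>The supremum is squeezed between 0 and the sum of the absolute deviations, a finite sum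
  of null sequences.\<close>

lemma tendsto_sup_dev:
  assumes "r \<ge> 1" and "\<And>j. j \<in> {1..r} \<Longrightarrow> (\<lambda>n. p' n j) \<longlonglongrightarrow> p j"
  shows "(\<lambda>n. sup_dev r (p' n) p) \<longlonglongrightarrow> 0"
proof (rule tendsto_sandwich)
  show "\<forall>\<^sub>F n in sequentially. 0 \<le> sup_dev r (p' n) p"
    using sup_dev_nonneg[OF assms(1)] by simp
  show "\<forall>\<^sub>F n in sequentially. sup_dev r (p' n) p \<le> (\<Sum>j=1..r. \<bar>p' n j - p j\<bar>)"
  proof (intro always_eventually allI)
    fix n
    show "sup_dev r (p' n) p \<le> (\<Sum>j=1..r. \<bar>p' n j - p j\<bar>)"
      unfolding sup_dev_def
      by (rule cSUP_least) (use assms(1) in \<open>auto intro!: member_le_sum\<close>)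
  qed
  have "(\<lambda>n. \<Sum>j=1..r. \<bar>p' n j - p j\<bar>) \<longlonglongrightarrow> (\<Sum>j=1..r. \<bar>p j - p j\<bar>)"
    by (intro tendsto_intros assms(2))
  then show "(\<lambda>n. \<Sum>j=1..r. \<bar>p' n j - p j\<bar>) \<longlonglongrightarrow> 0"
    by simp
qed simp

lemma (in prob_space) AE_sup_dev_tendsto:
  assumes "r \<ge> 1" and "iid_sample M r c p X"
  shows "AE \<omega> in M. (\<lambda>n. sup_dev r (empirical c X n \<omega>) p) \<longlonglongrightarrow> 0"
proof -
  have "AE \<omega> in M. \<forall>j\<in>{1..r}. (\<lambda>n. empirical c X n \<omega> j) \<longlonglongrightarrow> p j"
    by (intro AE_finite_allI AE_empirical_tendsto[OF assms(2)]) auto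
  then show ?thesis
    by eventually_elim (intro tendsto_sup_dev assms(1), auto)
qed

section \<open>First-order expansion on the unit square\<close>

text \<open>A derivative within [0,1] is also one within any segment contained in [0,1], so the mean
  value bound covers endpoints with one-sided derivatives. Asking for \<open>B\<close> only on the
  segment lets it depend on the two points.\<close>

lemma mean_value_bound_unit_interval:
  fixes f :: "real \<Rightarrow> real"
  assumes "\<And>u. u \<in> {0..1} \<Longrightarrow> f differentiable (at u within {0..1})"
    and "x \<in> {0..1}" "y \<in> {0..1}"
    and "\<And>u. u \<in> closed_segment y x \<Longrightarrow> \<bar>vector_derivative f (at u within {0..1})\<bar> \<le> B"
  shows "\<bar>f x - f y\<bar> \<le> B * \<bar>x - y\<bar>"
proof -
  have sub: "closed_segment y x \<subseteq> {0..1}"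
    using assms(2,3) by (auto simp: closed_segment_eq_real_ivl split: if_splits)
  have "norm (f x - f y) \<le> B * norm (x - y)"
  proof (rule field_differentiable_bound[where S = "closed_segment y x"])
    fix u assume u: "u \<in> closed_segment y x"
    have "(f has_vector_derivative vector_derivative f (at u within {0..1})) (at u within {0..1})"
      using assms(1) u sub vector_derivative_works by blast
    then show "(f has_field_derivative vector_derivative f (at u within {0..1}))
        (at u within closed_segment y x)"
      unfolding has_real_derivative_iff_has_vector_derivative
      by (rule has_vector_derivative_within_subset[OF _ sub])
  qed (use assms(4) in auto)
  then show ?thesis by simp
qed

text \<open>Two axis-parallel legs through the corner (x, t) join the points, and each leg involves
  one partial derivative only. The later use takes for \<open>g\<close> the first partial
  derivatives of \<open>\<phi>\<close>.\<close>

lemma has_pds_lipschitz: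
  assumes "has_pds g"
    and "\<And>s t. s \<in> {0..1} \<Longrightarrow> t \<in> {0..1} \<Longrightarrow> \<bar>pd1 g s t\<bar> \<le> K \<and> \<bar>pd2 g s t\<bar> \<le> K"
    and "s \<in> {0..1}" "t \<in> {0..1}" "x \<in> {0..1}" "y \<in> {0..1}"
  shows "\<bar>g s t - g x y\<bar> \<le> K * (\<bar>s - x\<bar> + \<bar>t - y\<bar>)"
proof -
  have sub: "closed_segment x s \<subseteq> {0..1}" "closed_segment y t \<subseteq> {0..1}"
    using assms(3-6) by (auto simp: closed_segment_eq_real_ivl split: if_splits)
  have "\<bar>g s t - g x t\<bar> \<le> K * \<bar>s - x\<bar>"
    by (rule mean_value_bound_unit_interval)
       (use assms sub in \<open>auto simp: has_pds_def pd1_def[symmetric]\<close>)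
  moreover have "\<bar>g x t - g x y\<bar> \<le> K * \<bar>t - y\<bar>"
    by (rule mean_value_bound_unit_interval)
       (use assms sub in \<open>auto simp: has_pds_def pd2_def[symmetric]\<close>)
  ultimately show ?thesis
    by (simp add: distrib_left)
qed

lemma continuous_on_unit_square_bounded:
  assumes "continuous_on ({0..1::real} \<times> {0..1::real}) (\<lambda>(s, t). g s t :: real)"
  shows "\<exists>K. \<forall>s\<in>{0..1}. \<forall>t\<in>{0..1}. \<bar>g s t\<bar> \<le> K"
proof -
  have "compact ((\<lambda>(s, t). g s t) ` ({0..1} \<times> {0..1}))"
    by (intro compact_continuous_image assms compact_Times) auto
  then have "bounded ((\<lambda>(s, t). g s t) ` ({0..1} \<times> {0..1}))"
    by (rule compact_imp_bounded)
  then show ?thesis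
    unfolding bounded_iff by fastforce
qed

text \<open>Along the legs from (x, y) to (x, t) and on to (s, t), a first partial derivative
  departs from its value at (x, y) by at most K times the displacement, since the bounded second
  derivatives make it Lipschitz. The mean value bound on each leg multiplies this error by a further
  displacement.\<close>

lemma C2_first_order_bound:
  assumes "C2_unit_square \<phi>"
  obtains K where "K \<ge> 0"
    and "\<And>s t x y. s \<in> {0..1} \<Longrightarrow> t \<in> {0..1} \<Longrightarrow> x \<in> {0..1} \<Longrightarrow> y \<in> {0..1} \<Longrightarrow>
      \<bar>\<phi> s t - \<phi> x y\<bar> \<le> \<bar>pd1 \<phi> x y\<bar> * \<bar>s - x\<bar> + \<bar>pd2 \<phi> x y\<bar> * \<bar>t - y\<bar>
        + K * (\<bar>s - x\<bar> + \<bar>t - y\<bar>)\<^sup>2"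
proof -
  have pds: "has_pds \<phi>" "has_pds (pd1 \<phi>)" "has_pds (pd2 \<phi>)"
    and cont: "\<And>\<psi>. \<psi> \<in> {pd1 (pd1 \<phi>), pd2 (pd1 \<phi>), pd1 (pd2 \<phi>), pd2 (pd2 \<phi>)} \<Longrightarrow>
      continuous_on ({0..1} \<times> {0..1}) (\<lambda>(s, t). \<psi> s t)"
    using assms unfolding C2_unit_square_def by blast+
  have "\<forall>\<psi>\<in>{pd1 (pd1 \<phi>), pd2 (pd1 \<phi>), pd1 (pd2 \<phi>), pd2 (pd2 \<phi>)}.
      \<exists>K. \<forall>s\<in>{0..1}. \<forall>t\<in>{0..1}. \<bar>\<psi> s t\<bar> \<le> K"
    using cont continuous_on_unit_square_bounded by blast
  then obtain B where B: "\<And>\<psi> s t.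
      \<psi> \<in> {pd1 (pd1 \<phi>), pd2 (pd1 \<phi>), pd1 (pd2 \<phi>), pd2 (pd2 \<phi>)} \<Longrightarrow>
      s \<in> {0..1} \<Longrightarrow> t \<in> {0..1} \<Longrightarrow> \<bar>\<psi> s t\<bar> \<le> B \<psi>"
    by metis
  \<comment> \<open>One constant serves all four second derivatives; the inserted 0 yields
    \<open>K \<ge> 0\<close>.\<close>
  define K where
    "K = Max (insert 0 (B ` {pd1 (pd1 \<phi>), pd2 (pd1 \<phi>), pd1 (pd2 \<phi>), pd2 (pd2 \<phi>)}))"
  have K: "\<bar>\<psi> s t\<bar> \<le> K"
    if "\<psi> \<in> {pd1 (pd1 \<phi>), pd2 (pd1 \<phi>), pd1 (pd2 \<phi>), pd2 (pd2 \<phi>)}"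
      "s \<in> {0..1}" "t \<in> {0..1}" for \<psi> s t
    using B[OF that] that(1) unfolding K_def
    by (intro order.trans[OF B[OF that]] Max_ge) auto
  have "K \<ge> 0"
    unfolding K_def by (intro Max_ge) auto
  have lip: "\<bar>g s t - g x y\<bar> \<le> K * (\<bar>s - x\<bar> + \<bar>t - y\<bar>)"
    if "g \<in> {pd1 \<phi>, pd2 \<phi>}" "s \<in> {0..1}" "t \<in> {0..1}" "x \<in> {0..1}" "y \<in> {0..1}" for g s t x y
    by (rule has_pds_lipschitz) (use that pds K in auto)
  show ?thesis
  proof (rule that[OF \<open>K \<ge> 0\<close>])
    fix s t x y :: real
    assume st: "s \<in> {0..1}" "t \<in> {0..1}" and xy: "x \<in> {0..1}" "y \<in> {0..1}"
    have sub: "closed_segment x s \<subseteq> {0..1}" "closed_segment y t \<subseteq> {0..1}"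
      using st xy by (auto simp: closed_segment_eq_real_ivl split: if_splits)
    \<comment> \<open>This leg runs at height t, while the reference derivative is taken at height
      y; hence the extra term in \<open>\<bar>t - y\<bar>\<close>, absent from the other leg, which
      stays on the line through x.\<close>
    have "\<bar>\<phi> s t - \<phi> x t\<bar> \<le> (\<bar>pd1 \<phi> x y\<bar> + K * (\<bar>s - x\<bar> + \<bar>t - y\<bar>)) * \<bar>s - x\<bar>"
    proof (rule mean_value_bound_unit_interval)
      fix u assume u: "u \<in> closed_segment x s"
      then have "\<bar>u - x\<bar> \<le> \<bar>s - x\<bar>"
        by (auto simp: closed_segment_eq_real_ivl split: if_splits)
      then have "K * (\<bar>u - x\<bar> + \<bar>t - y\<bar>) \<le> K * (\<bar>s - x\<bar> + \<bar>t - y\<bar>)"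
        using \<open>K \<ge> 0\<close> by (intro mult_left_mono) auto
      moreover have "\<bar>pd1 \<phi> u t - pd1 \<phi> x y\<bar> \<le> K * (\<bar>u - x\<bar> + \<bar>t - y\<bar>)"
        using u sub st xy by (intro lip) auto
      ultimately show "\<bar>vector_derivative (\<lambda>u. \<phi> u t) (at u within {0..1})\<bar>
          \<le> \<bar>pd1 \<phi> x y\<bar> + K * (\<bar>s - x\<bar> + \<bar>t - y\<bar>)"
        unfolding pd1_def[symmetric] by linarith
    qed (use pds st xy in \<open>auto simp: has_pds_def\<close>)
    moreover have "\<bar>\<phi> x t - \<phi> x y\<bar> \<le> (\<bar>pd2 \<phi> x y\<bar> + K * \<bar>t - y\<bar>) * \<bar>t - y\<bar>"
    proof (rule mean_value_bound_unit_interval)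
      fix u assume u: "u \<in> closed_segment y t"
      then have "\<bar>u - y\<bar> \<le> \<bar>t - y\<bar>"
        by (auto simp: closed_segment_eq_real_ivl split: if_splits)
      then have "K * \<bar>u - y\<bar> \<le> K * \<bar>t - y\<bar>"
        using \<open>K \<ge> 0\<close> by (intro mult_left_mono) auto
      moreover have "\<bar>pd2 \<phi> x u - pd2 \<phi> x y\<bar> \<le> K * (\<bar>x - x\<bar> + \<bar>u - y\<bar>)"
        using u sub st xy by (intro lip) auto
      ultimately show "\<bar>vector_derivative (\<lambda>u. \<phi> x u) (at u within {0..1})\<bar>
          \<le> \<bar>pd2 \<phi> x y\<bar> + K * \<bar>t - y\<bar>"
        unfolding pd2_def[symmetric] by simp
    qed (use pds st xy in \<open>auto simp: has_pds_def\<close>)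
    \<comment> \<open>With a and b for the two displacements, the legs leave the remainder K (a^2 +
      a b + b^2). Adding the nonnegative K a b completes the square.\<close>
    moreover have "0 \<le> K * (\<bar>s - x\<bar> * \<bar>t - y\<bar>)"
      using \<open>K \<ge> 0\<close> by simp
    moreover have "\<bar>\<phi> s t - \<phi> x y\<bar> \<le> \<bar>\<phi> s t - \<phi> x t\<bar> + \<bar>\<phi> x t - \<phi> x y\<bar>"
      by simp
    ultimately show "\<bar>\<phi> s t - \<phi> x y\<bar> \<le> \<bar>pd1 \<phi> x y\<bar> * \<bar>s - x\<bar> + \<bar>pd2 \<phi> x y\<bar> * \<bar>t - y\<bar>
        + K * (\<bar>s - x\<bar> + \<bar>t - y\<bar>)\<^sup>2"
      by (simp add: algebra_simps power2_eq_square)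
  qed
qed

text \<open>Summing the pointwise expansion over the r coordinates gives C = r K. It is chosen
  before all vectors, hence uniform in the sample sizes and the outcome. Separate bounds
  \<open>d\<close> and \<open>e\<close> allow one of them to be 0 when only one distribution is
  estimated.\<close>

lemma phi_div_first_order_bound:
  assumes "C2_unit_square \<phi>"
  obtains C where "C \<ge> 0"
    and "\<And>p q p' q' d e.
      (\<And>j. j \<in> {1..r} \<Longrightarrow> p j \<in> {0..1} \<and> q j \<in> {0..1} \<and> p' j \<in> {0..1} \<and> q' j \<in> {0..1}) \<Longrightarrow>
      (\<And>j. j \<in> {1..r} \<Longrightarrow> \<bar>p' j - p j\<bar> \<le> d \<and> \<bar>q' j - q j\<bar> \<le> e) \<Longrightarrow>
      \<bar>phi_div r \<phi> p' q' - phi_div r \<phi> p q\<bar> \<le> A1 r \<phi> p q * d + A2 r \<phi> p q * e + C * (d + e)\<^sup>2"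
proof -
  obtain K where "K \<ge> 0" and K: "\<And>s t x y.
      s \<in> {0..1} \<Longrightarrow> t \<in> {0..1} \<Longrightarrow> x \<in> {0..1} \<Longrightarrow> y \<in> {0..1} \<Longrightarrow>
      \<bar>\<phi> s t - \<phi> x y\<bar> \<le> \<bar>pd1 \<phi> x y\<bar> * \<bar>s - x\<bar> + \<bar>pd2 \<phi> x y\<bar> * \<bar>t - y\<bar>
        + K * (\<bar>s - x\<bar> + \<bar>t - y\<bar>)\<^sup>2"
    using C2_first_order_bound[OF assms] by blast
  show ?thesis
  proof (rule that[of "real r * K"])
    fix p q p' q' :: "nat \<Rightarrow> real" and d e :: real
    assume unit: "\<And>j. j \<in> {1..r} \<Longrightarrow>
        p j \<in> {0..1} \<and> q j \<in> {0..1} \<and> p' j \<in> {0..1} \<and> q' j \<in> {0..1}"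
      and dev: "\<And>j. j \<in> {1..r} \<Longrightarrow> \<bar>p' j - p j\<bar> \<le> d \<and> \<bar>q' j - q j\<bar> \<le> e"
    have "\<bar>phi_div r \<phi> p' q' - phi_div r \<phi> p q\<bar> \<le> (\<Sum>j=1..r. \<bar>\<phi> (p' j) (q' j) - \<phi> (p j) (q j)\<bar>)"
      unfolding phi_div_def sum_subtractf[symmetric] by (rule sum_abs)
    also have "\<dots> \<le> (\<Sum>j=1..r. \<bar>pd1 \<phi> (p j) (q j)\<bar> * d + \<bar>pd2 \<phi> (p j) (q j)\<bar> * e + K * (d + e)\<^sup>2)"
    proof (rule sum_mono)
      fix j assume j: "j \<in> {1..r}"
      have "\<bar>\<phi> (p' j) (q' j) - \<phi> (p j) (q j)\<bar>
          \<le> \<bar>pd1 \<phi> (p j) (q j)\<bar> * \<bar>p' j - p j\<bar> + \<bar>pd2 \<phi> (p j) (q j)\<bar> * \<bar>q' j - q j\<bar>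
            + K * (\<bar>p' j - p j\<bar> + \<bar>q' j - q j\<bar>)\<^sup>2"
        using unit[OF j] by (intro K) auto
      also have "\<dots> \<le> \<bar>pd1 \<phi> (p j) (q j)\<bar> * d + \<bar>pd2 \<phi> (p j) (q j)\<bar> * e + K * (d + e)\<^sup>2"
        using dev[OF j] \<open>K \<ge> 0\<close> by (intro add_mono mult_left_mono power_mono) auto
      finally show "\<bar>\<phi> (p' j) (q' j) - \<phi> (p j) (q j)\<bar>
          \<le> \<bar>pd1 \<phi> (p j) (q j)\<bar> * d + \<bar>pd2 \<phi> (p j) (q j)\<bar> * e + K * (d + e)\<^sup>2" .
    qed
    also have "\<dots> = A1 r \<phi> p q * d + A2 r \<phi> p q * e + real r * K * (d + e)\<^sup>2"
      by (simp add: A1_def A2_def sum.distrib sum_distrib_right)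
    finally show "\<bar>phi_div r \<phi> p' q' - phi_div r \<phi> p q\<bar>
        \<le> A1 r \<phi> p q * d + A2 r \<phi> p q * e + real r * K * (d + e)\<^sup>2" .
  qed (use \<open>K \<ge> 0\<close> in simp)
qed

section \<open>Limits of the ratios\<close>

(* x / 0 = 0 makes this hold for d = 0 as well. *)
lemma divide_le_of_le_quadratic:
  fixes x d A C :: real
  assumes "x \<le> A * d + C * d\<^sup>2" "0 \<le> d" "0 \<le> A"
  shows "x / d \<le> A + C * d"
proof (cases "d = 0")
  case False
  then have "d > 0" using assms(2) by simp
  moreover have "x \<le> (A + C * d) * d"
    using assms(1) by (simp add: distrib_right power2_eq_square)
  ultimately show ?thesis by (simp add: pos_divide_le_eq)
qed (use assms(3) in simp)

lemma limsup_le_of_le_linear: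
  fixes x d :: "nat \<Rightarrow> real"
  assumes "\<And>n. x n \<le> A + C * d n" and "d \<longlonglongrightarrow> 0"
  shows "limsup (\<lambda>n. ereal (x n)) \<le> ereal A"
proof -
  have "(\<lambda>n. A + C * d n) \<longlonglongrightarrow> A + C * 0"
    by (intro tendsto_intros assms(2))
  then have "(\<lambda>n. ereal (A + C * d n)) \<longlonglongrightarrow> ereal A"
    by simp
  then have "limsup (\<lambda>n. ereal (A + C * d n)) = ereal A"
    by (intro lim_imp_Limsup) auto
  moreover have "limsup (\<lambda>n. ereal (x n)) \<le> limsup (\<lambda>n. ereal (A + C * d n))"
    using assms(1) by (intro Limsup_mono) auto
  ultimately show ?thesis by simp
qed

text \<open>The tail suprema decrease, so their limit is their infimum, and for each \<epsilon> a
  single tail with supremum at most A + \<epsilon> suffices. Such a tail starts where both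
  \<open>d\<close> and \<open>e\<close> have become small.\<close>

lemma double_limsup_le_of_le_linear:
  fixes x :: "nat \<Rightarrow> nat \<Rightarrow> real" and d e :: "nat \<Rightarrow> real"
  assumes "\<And>n m. x n m \<le> A + C * max (d n) (e m)"
    and "C \<ge> 0" and "d \<longlonglongrightarrow> 0" and "e \<longlonglongrightarrow> 0"
  shows "double_limsup (\<lambda>n m. ereal (x n m)) \<le> ereal A"
proof -
  define S where "S N = (SUP (n, m)\<in>{N..} \<times> {N..}. ereal (x n m))" for N :: nat
  have "decseq S"
    unfolding S_def by (intro antimonoI SUP_subset_mono Sigma_mono order_refl) simp_all
  then have lim: "S \<longlonglongrightarrow> (INF N. S N)"
    by (rule LIMSEQ_INF)
  have "(INF N. S N) \<le> ereal A + ereal \<epsilon>" if "\<epsilon> > 0" for \<epsilon>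
  proof -
    \<comment> \<open>The denominator C + 1 keeps \<open>\<delta>\<close> well defined and positive
      also for C = 0.\<close>
    define \<delta> where "\<delta> = \<epsilon> / (C + 1)"
    have "\<delta> > 0"
      using that \<open>C \<ge> 0\<close> by (simp add: \<delta>_def)
    have "(C + 1) * \<delta> = \<epsilon>"
      using \<open>C \<ge> 0\<close> by (simp add: \<delta>_def)
    then have "C * \<delta> \<le> \<epsilon>"
      using \<open>\<delta> > 0\<close> by (simp add: distrib_right)
    have "\<forall>\<^sub>F n in sequentially. d n < \<delta> \<and> e n < \<delta>"
      using order_tendstoD(2)[OF assms(3) \<open>\<delta> > 0\<close>] order_tendstoD(2)[OF assms(4) \<open>\<delta> > 0\<close>]
      by (rule eventually_conj)
    then obtain N where N: "\<And>n. n \<ge> N \<Longrightarrow> d n < \<delta> \<and> e n < \<delta>"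
      unfolding eventually_sequentially by blast
    have "S N \<le> ereal (A + \<epsilon>)"
      unfolding S_def
    proof (rule SUP_least, clarify)
      fix n m assume "N \<le> n" "N \<le> m"
      then have "C * max (d n) (e m) \<le> C * \<delta>"
        using N[of n] N[of m] \<open>C \<ge> 0\<close> by (intro mult_left_mono) auto
      then show "ereal (x n m) \<le> ereal (A + \<epsilon>)"
        using assms(1)[of n m] \<open>C * \<delta> \<le> \<epsilon>\<close> by simp
    qed
    then show ?thesis
      by (intro INF_lower2[of N]) simp_all
  qed
  then have "(INF N. S N) \<le> ereal A"
    by (rule ereal_le_epsilon2)
  then show ?thesis
    using limI[OF lim] by (simp add: double_limsup_def S_def[abs_def])
qed

section \<open>The almost sure bounds for one and two samples\<close>

theorem theorem1:
  fixes M :: "'a measure"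
    and r :: nat
    and c :: "nat \<Rightarrow> 'c"
    and p q :: "nat \<Rightarrow> real"
    and X Y :: "nat \<Rightarrow> 'a \<Rightarrow> 'c"
    and \<phi> :: "real \<Rightarrow> real \<Rightarrow> real"
  assumes "prob_space M"
    and "r \<ge> 2"
    and "inj_on c {1..r}"
    and "prob_vec r p" and "prob_vec r q"
    and "\<forall>j\<in>{1..r}. p j > 0" and "\<forall>j\<in>{1..r}. q j > 0"
    and "iid_sample M r c p X" and "iid_sample M r c q Y"
    and "indep_samples M r c X Y"
    and "(\<lambda>(s, t). \<phi> s t) \<in> borel_measurable (restrict_space borel ({0..1} \<times> {0..1}))"
    and "C2_unit_square \<phi>"
  shows "(AE \<omega> in M.
            limsup (\<lambda>n. ereal (\<bar>phi_div r \<phi> (empirical c X n \<omega>) q - phi_div r \<phi> p q\<bar>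
                               / sup_dev r (empirical c X n \<omega>) p))
            \<le> ereal (A1 r \<phi> p q))
       \<and> (AE \<omega> in M.
            limsup (\<lambda>m. ereal (\<bar>phi_div r \<phi> p (empirical c Y m \<omega>) - phi_div r \<phi> p q\<bar>
                               / sup_dev r (empirical c Y m \<omega>) q))
            \<le> ereal (A2 r \<phi> p q))
       \<and> (AE \<omega> in M.
            double_limsup (\<lambda>n m.
              ereal (\<bar>phi_div r \<phi> (empirical c X n \<omega>) (empirical c Y m \<omega>) - phi_div r \<phi> p q\<bar>
                     / max (sup_dev r (empirical c X n \<omega>) p) (sup_dev r (empirical c Y m \<omega>) q)))
            \<le> ereal (A1 r \<phi> p q + A2 r \<phi> p q))"
proof -
  interpret prob_space M by fact
  have "r \<ge> 1" using \<open>r \<ge> 2\<close> by simp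
  \<comment> \<open>The expansion holds on the unit square, so the true vectors must be located
    there, as the empirical ones already are; an empty sample has empirical vector 0.\<close>
  have unit: "v j \<in> {0..1}" if "prob_vec r v" "j \<in> {1..r}" for v j
  proof -
    have "v j \<le> (\<Sum>j=1..r. v j)"
      using that by (intro member_le_sum) (auto simp: prob_vec_def)
    then show ?thesis
      using that by (auto simp: prob_vec_def)
  qed
  note p = unit[OF \<open>prob_vec r p\<close>] and q = unit[OF \<open>prob_vec r q\<close>]
  note emp = empirical_in_unit_interval
  have A: "0 \<le> A1 r \<phi> p q" "0 \<le> A2 r \<phi> p q"
    by (auto simp: A1_def A2_def intro!: sum_nonneg)
  obtain C where "C \<ge> 0" and C: "\<And>p q p' q' d e.
      (\<And>j. j \<in> {1..r} \<Longrightarrow> p j \<in> {0..1} \<and> q j \<in> {0..1} \<and> p' j \<in> {0..1} \<and> q' j \<in> {0..1}) \<Longrightarrow>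
      (\<And>j. j \<in> {1..r} \<Longrightarrow> \<bar>p' j - p j\<bar> \<le> d \<and> \<bar>q' j - q j\<bar> \<le> e) \<Longrightarrow>
      \<bar>phi_div r \<phi> p' q' - phi_div r \<phi> p q\<bar> \<le> A1 r \<phi> p q * d + A2 r \<phi> p q * e + C * (d + e)\<^sup>2"
    using phi_div_first_order_bound[OF \<open>C2_unit_square \<phi>\<close>, where r = r] by blast
  let ?a = "\<lambda>n \<omega>. sup_dev r (empirical c X n \<omega>) p"
  let ?b = "\<lambda>m \<omega>. sup_dev r (empirical c Y m \<omega>) q"
  have nonneg: "0 \<le> ?a n \<omega>" "0 \<le> ?b n \<omega>" for n \<omega>
    using sup_dev_nonneg[OF \<open>r \<ge> 1\<close>] by auto
  have a: "AE \<omega> in M. (\<lambda>n. ?a n \<omega>) \<longlonglongrightarrow> 0"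
    by (rule AE_sup_dev_tendsto) fact+
  have b: "AE \<omega> in M. (\<lambda>m. ?b m \<omega>) \<longlonglongrightarrow> 0"
    by (rule AE_sup_dev_tendsto) fact+
  \<comment> \<open>The ratio bounds are pathwise: they hold for every sample size and every
    outcome, with 0/0 read as 0. Since \<open>q\<close> is kept exact, e = 0 removes the
    \<open>A2\<close> term.\<close>
  have one_p: "\<bar>phi_div r \<phi> (empirical c X n \<omega>) q - phi_div r \<phi> p q\<bar> / ?a n \<omega>
      \<le> A1 r \<phi> p q + C * ?a n \<omega>" for n \<omega>
  proof (rule divide_le_of_le_quadratic)
    have "\<bar>phi_div r \<phi> (empirical c X n \<omega>) q - phi_div r \<phi> p q\<bar>
        \<le> A1 r \<phi> p q * ?a n \<omega> + A2 r \<phi> p q * 0 + C * (?a n \<omega> + 0)\<^sup>2"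
      by (intro C conjI p q emp abs_diff_le_sup_dev) auto
    then show "\<bar>phi_div r \<phi> (empirical c X n \<omega>) q - phi_div r \<phi> p q\<bar>
        \<le> A1 r \<phi> p q * ?a n \<omega> + C * (?a n \<omega>)\<^sup>2"
      by simp
  qed (use A nonneg in auto)
  have one_q: "\<bar>phi_div r \<phi> p (empirical c Y m \<omega>) - phi_div r \<phi> p q\<bar> / ?b m \<omega>
      \<le> A2 r \<phi> p q + C * ?b m \<omega>" for m \<omega>
  proof (rule divide_le_of_le_quadratic)
    have "\<bar>phi_div r \<phi> p (empirical c Y m \<omega>) - phi_div r \<phi> p q\<bar>
        \<le> A1 r \<phi> p q * 0 + A2 r \<phi> p q * ?b m \<omega> + C * (0 + ?b m \<omega>)\<^sup>2"
      by (intro C conjI p q emp abs_diff_le_sup_dev) auto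
    then show "\<bar>phi_div r \<phi> p (empirical c Y m \<omega>) - phi_div r \<phi> p q\<bar>
        \<le> A2 r \<phi> p q * ?b m \<omega> + C * (?b m \<omega>)\<^sup>2"
      by simp
  qed (use A nonneg in auto)
  have two: "\<bar>phi_div r \<phi> (empirical c X n \<omega>) (empirical c Y m \<omega>) - phi_div r \<phi> p q\<bar>
        / max (?a n \<omega>) (?b m \<omega>)
      \<le> (A1 r \<phi> p q + A2 r \<phi> p q) + 4 * C * max (?a n \<omega>) (?b m \<omega>)" for n m \<omega>
  proof (rule divide_le_of_le_quadratic)
    let ?d = "max (?a n \<omega>) (?b m \<omega>)"
    \<comment> \<open>The larger deviation \<open>?d\<close> bounds both samples, so d = e =
      \<open>?d\<close>; the factor 4 comes from (2 \<open>?d\<close>)^2.\<close>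
    have "\<bar>phi_div r \<phi> (empirical c X n \<omega>) (empirical c Y m \<omega>) - phi_div r \<phi> p q\<bar>
        \<le> A1 r \<phi> p q * ?d + A2 r \<phi> p q * ?d + C * (?d + ?d)\<^sup>2"
      by (intro C conjI p q emp max.coboundedI1[OF abs_diff_le_sup_dev]
            max.coboundedI2[OF abs_diff_le_sup_dev]) auto
    also have "\<dots> = (A1 r \<phi> p q + A2 r \<phi> p q) * ?d + 4 * C * ?d\<^sup>2"
      by (simp add: algebra_simps power2_eq_square)
    finally show "\<bar>phi_div r \<phi> (empirical c X n \<omega>) (empirical c Y m \<omega>) - phi_div r \<phi> p q\<bar>
        \<le> (A1 r \<phi> p q + A2 r \<phi> p q) * ?d + 4 * C * ?d\<^sup>2" .
  qed (use A nonneg in \<open>auto simp: le_max_iff_disj\<close>)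
  show ?thesis
  proof (intro conjI)
    show "AE \<omega> in M. limsup (\<lambda>n. ereal (\<bar>phi_div r \<phi> (empirical c X n \<omega>) q - phi_div r \<phi> p q\<bar>
        / ?a n \<omega>)) \<le> ereal (A1 r \<phi> p q)"
      using a by eventually_elim (rule limsup_le_of_le_linear[OF one_p])
    show "AE \<omega> in M. limsup (\<lambda>m. ereal (\<bar>phi_div r \<phi> p (empirical c Y m \<omega>) - phi_div r \<phi> p q\<bar>
        / ?b m \<omega>)) \<le> ereal (A2 r \<phi> p q)"
      using b by eventually_elim (rule limsup_le_of_le_linear[OF one_q])
    show "AE \<omega> in M. double_limsup (\<lambda>n m. ereal (
        \<bar>phi_div r \<phi> (empirical c X n \<omega>) (empirical c Y m \<omega>) - phi_div r \<phi> p q\<bar>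
        / max (?a n \<omega>) (?b m \<omega>))) \<le> ereal (A1 r \<phi> p q + A2 r \<phi> p q)"
      \<comment> \<open>On the intersection of the two almost sure events both deviations tend to 0,
        so the joint limit reduces to a deterministic statement for each outcome.\<close>
      using a b
    proof eventually_elim
      case (elim \<omega>)
      show ?case
        by (rule double_limsup_le_of_le_linear[OF two _ elim]) (use \<open>C \<ge> 0\<close> in simp)
    qed
  qed
qed

end
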